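(* For every integer $n\ge 0$, $$ H_n(3) = (-1)^n \prod_{i=1}^n \frac{ (6i-3)!\,(3i+2)!\,(2i-1)!} {(4i-1)!\,(4i+1)!\,(3i-2)!}. $$
   Context: For $k\ge 0$ let $a_k(x)=\sum_{m=0}^{k}\binom{3k+1-m}{k-m}x^m$, and for $n\ge 0$ let $H_n(x)=\det[a_{i+j}(x)]_{0\le i,j\le n}$ be the $(n+1)\times(n+1)$ Hankel determinant. Empty products equal $1$. *)

theory Defs
  imports "Jordan_Normal_Form.Determinant"
begin

definition a_seq :: "nat \<Rightarrow> 'a::comm_ring_1 \<Rightarrow> 'a" where
  "a_seq k x = (\<Sum>m=0..k. of_nat ((3 * k + 1 - m) choose (k - m)) * x ^ m)"

definition hankel_H :: "nat \<Rightarrow> 'a::comm_ring_1 \<Rightarrow> 'a" where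
  "hankel_H n x = det (mat (n + 1) (n + 1) (\<lambda>(i, j). a_seq (i + j) x))"

end

theory Submission
  imports Defs "HOL-Computational_Algebra.Formal_Power_Series"
begin

text \<open>
  At \<open>x = 3\<close> the generating function \<open>f = \<Sum>\<^sub>k a\<^sub>k(3) X\<^sup>k\<close> is a logarithmic derivative: with
  \<open>G = \<Sum>\<^sub>k (3k choose k) X\<^sup>k\<close> one has \<open>3 f G = G'\<close>. Both \<open>G\<close> and \<open>G'\<close> are
  hypergeometric, namely \<open>G = F(1/3, 2/3; 1/2; 27X/4)\<close> and
  \<open>G'/3 = F(4/3, 5/3; 3/2; 27X/4)\<close>, so \<open>f\<close> is a quotient of two contiguous Gauss series and
  has an explicit continued fraction.

  The logarithmic derivative is found by means of the series \<open>t = 1 + X t\<^sup>3\<close>. Pascal's rule makes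
  the series \<open>\<Sum>\<^sub>k (3k+r choose k) X\<^sup>k\<close>, and their analogues weighted by powers of \<open>x\<close>,
  proportional to \<open>t\<^sup>r\<close> (\<open>ternary_family\<close>). Together with \<open>G (1 - 3Xt\<^sup>2) = 1\<close> this gives
  \<open>f = t G\<^sup>2\<close> and \<open>G' = 3 t G\<^sup>3\<close> (\<open>a_fps_logarithmic_derivative\<close>).

  For the continued fraction put
  \<open>\<psi>\<^sub>n = F(n + 4/3, n + 5/3; 2n + 3/2; 27X/4)\<close>. Gauss's contiguous relations yield
  \<open>\<psi>\<^sub>n = (1 - b\<^sub>n\<^sub>+\<^sub>1 X) \<psi>\<^sub>n\<^sub>+\<^sub>1 - \<lambda>\<^sub>n\<^sub>+\<^sub>1 X\<^sup>2 \<psi>\<^sub>n\<^sub>+\<^sub>2\<close> (\<open>psi_step\<close>), and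
  \<open>G = (1 - 7X) \<psi>\<^sub>0 - \<lambda>\<^sub>0 X\<^sup>2 \<psi>\<^sub>1\<close> (\<open>psi_start\<close>). The coefficients of the series
  \<open>X\<^sup>n \<psi>\<^sub>n / G\<close> are then the columns of a unit lower triangular matrix \<open>S\<close>, and the Hankel
  matrix of \<open>f = \<psi>\<^sub>0 / G\<close> factors as \<open>S D S\<^sup>T\<close>, where \<open>D\<close> is diagonal with entries
  \<open>\<Prod>\<^sub>j\<^sub><\<^sub>i \<lambda>\<^sub>j\<close> (\<open>hankel_det_three_term\<close>). For \<open>i \<ge> 1\<close> these entries are the
  negatives of the factorial quotients in the theorem (\<open>prod_lam\<close>).
\<close>

section \<open>Hankel determinants and three-term recurrences\<close>

text \<open>
  The right-hand side is symmetric in \<open>i\<close> and \<open>j\<close>, so that in the bilinear form with weights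
  \<open>h\<close> an index shift can be moved from one row of \<open>S\<close> to the other.
\<close>

lemma stieltjes_matrix_symmetry:
  fixes S :: "nat \<Rightarrow> nat \<Rightarrow> 'a::comm_ring_1" and b l :: "nat \<Rightarrow> 'a"
  defines "h \<equiv> \<lambda>n. \<Prod>j<n. l j"
  assumes rec_0: "\<And>k. S (Suc k) 0 = b 0 * S k 0 + l 0 * S k 1"
    and rec_Suc: "\<And>k n. S (Suc k) (Suc n) = S k n + b (Suc n) * S k (Suc n) + l (Suc n) * S k (Suc (Suc n))"
    and top: "S i (Suc N) = 0"
  shows "(\<Sum>n<Suc N. h n * S (Suc i) n * S j n) =
         (\<Sum>n<Suc N. b n * h n * S i n * S j n) +
         (\<Sum>n<N. h (Suc n) * (S i (Suc n) * S j n + S i n * S j (Suc n)))"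
proof -
  have h_Suc: "h (Suc n) = h n * l n" for n
    by (simp add: h_def mult.commute)
  have A: "(\<Sum>n<Suc N. h n * l n * S i (Suc n) * S j n) = (\<Sum>n<N. h (Suc n) * (S i (Suc n) * S j n))"
    using top by (simp add: h_Suc algebra_simps)
  have "(\<Sum>n<Suc N. h n * S (Suc i) n * S j n) =
      h 0 * S (Suc i) 0 * S j 0 + (\<Sum>n<N. h (Suc n) * S (Suc i) (Suc n) * S j (Suc n))"
    by (simp only: sum.lessThan_Suc_shift)
  also have "\<dots> = (\<Sum>n<Suc N. b n * h n * S i n * S j n) +
      (\<Sum>n<Suc N. h n * l n * S i (Suc n) * S j n) + (\<Sum>n<N. h (Suc n) * (S i n * S j (Suc n)))"
    unfolding sum.lessThan_Suc_shift rec_0 rec_Suc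
    by (simp add: sum.distrib algebra_simps)
  finally show ?thesis
    unfolding A by (simp add: sum.distrib algebra_simps)
qed

text \<open>
  The recurrence for \<open>S\<close> is that of a Stieltjes matrix: \<open>S k n\<close> counts weighted Motzkin
  paths of length \<open>k\<close> from height \<open>0\<close> to height \<open>n\<close>, with weight \<open>b n\<close> for a level
  step at height \<open>n\<close> and \<open>l n\<close> for a step down to height \<open>n\<close>.
\<close>

lemma hankel_det_stieltjes_matrix:
  fixes S :: "nat \<Rightarrow> nat \<Rightarrow> 'a::idom" and b l :: "nat \<Rightarrow> 'a"
  assumes init: "\<And>n. S 0 n = (if n = 0 then 1 else 0)"
    and rec_0: "\<And>k. S (Suc k) 0 = b 0 * S k 0 + l 0 * S k 1"
    and rec_Suc: "\<And>k n. S (Suc k) (Suc n) = S k n + b (Suc n) * S k (Suc n) + l (Suc n) * S k (Suc (Suc n))"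
  shows "det (mat (n + 1) (n + 1) (\<lambda>(i, j). S (i + j) 0)) = (\<Prod>i\<le>n. \<Prod>j<i. l j)"
proof -
  define h where "h = (\<lambda>n. \<Prod>j<n. l j)"
  have upper: "S k m = 0" if "k < m" for k m
    using that
  proof (induction k arbitrary: m)
    case 0
    then show ?case by (simp add: init)
  next
    case (Suc k)
    then obtain m' where "m = Suc m'" "k < m'" by (cases m) auto
    with Suc.IH show ?case by (simp add: rec_Suc)
  qed
  have diag: "S k k = 1" for k
    by (induction k) (simp_all add: init rec_Suc upper)
  \<comment> \<open>Bounding the sum by \<open>N\<close> beyond \<open>i + j\<close> keeps the bound fixed while a step moves from
    \<open>i\<close> to \<open>j\<close>.\<close>
  have gram: "(\<Sum>m<Suc N. h m * S i m * S j m) = S (i + j) 0" if "i + j < N" for i j N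
    using that
  proof (induction i arbitrary: j)
    case 0
    have "(\<Sum>m<Suc N. h m * S 0 m * S j m) = h 0 * S 0 0 * S j 0"
      unfolding sum.lessThan_Suc_shift by (simp add: init)
    then show ?case by (simp add: init h_def)
  next
    case (Suc i)
    have "(\<Sum>m<Suc N. h m * S (Suc i) m * S j m) = (\<Sum>m<Suc N. h m * S (Suc j) m * S i m)"
      unfolding h_def
      by (subst (1 2) stieltjes_matrix_symmetry[where S = S and b = b and l = l, OF rec_0 rec_Suc])
        (use Suc.prems in \<open>auto simp: upper algebra_simps\<close>)
    also have "\<dots> = (\<Sum>m<Suc N. h m * S i m * S (Suc j) m)"
      by (intro sum.cong refl) (simp only: ac_simps)
    also have "\<dots> = S (i + Suc j) 0"
      using Suc.prems by (intro Suc.IH) simp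
    finally show ?case by simp
  qed
  have gram': "(\<Sum>m<n+1. h m * S i m * S j m) = S (i + j) 0" if "i < n + 1" for i j
  proof -
    have "(\<Sum>m<n+1. h m * S i m * S j m) = (\<Sum>m<Suc (n + i + j + 1). h m * S i m * S j m)"
      using that by (intro sum.mono_neutral_left) (auto simp: upper)
    also have "\<dots> = S (i + j) 0" by (rule gram) simp
    finally show ?thesis .
  qed
  define L where "L = mat (n + 1) (n + 1) (\<lambda>(i, j). S i j)"
  define U where "U = mat (n + 1) (n + 1) (\<lambda>(i, j). h i * S j i)"
  have "mat (n + 1) (n + 1) (\<lambda>(i, j). S (i + j) 0) = L * U"
    by (rule eq_matI)
      (auto simp: L_def U_def scalar_prod_def gram'[symmetric] atLeast0LessThan mult.commute
         mult.left_commute simp del: sum.lessThan_Suc intro!: sum.cong)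
  moreover have "det L = 1"
  proof -
    have "det L = prod_list (diag_mat L)"
      by (rule det_lower_triangular[where n = "n + 1"]) (auto simp: L_def upper)
    also have "diag_mat L = map (\<lambda>_. 1) [0..<Suc n]"
      by (auto simp: L_def diag_mat_def diag simp del: upt_Suc)
    also have "prod_list \<dots> = 1"
      by (simp add: map_replicate_const del: upt_Suc)
    finally show ?thesis .
  qed
  moreover have "det U = (\<Prod>i\<le>n. h i)"
  proof -
    have "det U = prod_list (diag_mat U)"
      by (rule det_upper_triangular[where n = "n + 1"]) (auto simp: U_def upper)
    also have "\<dots> = prod_list (map h [0..<Suc n])"
      by (auto simp: U_def diag_mat_def diag intro!: arg_cong[where f = prod_list])
    also have "\<dots> = (\<Prod>i\<le>n. h i)"
      by (simp add: prod.distinct_set_conv_list[symmetric] atLeast0LessThan lessThan_Suc_atMost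
          del: upt_Suc)
    finally show ?thesis .
  qed
  ultimately show ?thesis
    by (simp add: h_def det_mult[where n = "n + 1"] L_def U_def)
qed

text \<open>
  The hypotheses say that \<open>f\<close> has the Jacobi continued fraction with coefficients \<open>b\<close> and
  \<open>l\<close>; up to the common factor \<open>1 / G\<close>, the \<open>\<psi> n\<close> are its successive remainders,
  divided by powers of \<open>X\<close> and normalised to constant term \<open>1\<close>.
\<close>

lemma hankel_det_three_term:
  fixes \<psi> :: "nat \<Rightarrow> 'a::field fps" and G f :: "'a fps" and b l :: "nat \<Rightarrow> 'a"
  assumes G0: "fps_nth G 0 = 1" and psi0: "\<And>n. fps_nth (\<psi> n) 0 = 1"
    and start: "G = (1 - fps_const (b 0) * fps_X) * \<psi> 0 - fps_const (l 0) * fps_X ^ 2 * \<psi> 1"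
    and step: "\<And>n. \<psi> n = (1 - fps_const (b (Suc n)) * fps_X) * \<psi> (Suc n)
                  - fps_const (l (Suc n)) * fps_X ^ 2 * \<psi> (Suc (Suc n))"
    and f: "f * G = \<psi> 0"
  shows "det (mat (n + 1) (n + 1) (\<lambda>(i, j). fps_nth f (i + j))) = (\<Prod>i\<le>n. \<Prod>j<i. l j)"
proof -
  define \<Phi> where "\<Phi> = (\<lambda>n. fps_X ^ n * \<psi> n * inverse G)"
  have inv: "G * inverse G = 1" "inverse G * G = 1"
    using G0 by (simp_all add: inverse_mult_eq_1 inverse_mult_eq_1')
  have f_eq: "f = \<Phi> 0"
    using f inv by (simp add: \<Phi>_def f[symmetric] mult.assoc)
  have Phi_0: "\<Phi> 0 = 1 + fps_X * (fps_const (b 0) * \<Phi> 0 + fps_const (l 0) * \<Phi> 1)"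
  proof -
    have "1 = G * inverse G" using inv by simp
    also have "\<dots> = \<Phi> 0 - fps_X * (fps_const (b 0) * \<Phi> 0 + fps_const (l 0) * \<Phi> 1)"
      by (subst start) (simp add: \<Phi>_def algebra_simps power2_eq_square)
    finally show ?thesis by (simp add: algebra_simps)
  qed
  have Phi_Suc: "\<Phi> (Suc n) = fps_X * (\<Phi> n + fps_const (b (Suc n)) * \<Phi> (Suc n)
      + fps_const (l (Suc n)) * \<Phi> (Suc (Suc n)))" for n
  proof -
    have "fps_X * \<Phi> n = \<Phi> (Suc n) - fps_X * (fps_const (b (Suc n)) * \<Phi> (Suc n)
      + fps_const (l (Suc n)) * \<Phi> (Suc (Suc n)))"
      unfolding \<Phi>_def by (subst step) (simp add: algebra_simps power2_eq_square)
    then show ?thesis by (simp add: algebra_simps)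
  qed
  have "det (mat (n + 1) (n + 1) (\<lambda>(i, j). fps_nth (\<Phi> 0) (i + j))) = (\<Prod>i\<le>n. \<Prod>j<i. l j)"
  proof (rule hankel_det_stieltjes_matrix[where S = "\<lambda>k n. fps_nth (\<Phi> n) k" and b = b])
    show "fps_nth (\<Phi> n) 0 = (if n = 0 then 1 else 0)" for n
      using G0 psi0 by (simp add: \<Phi>_def)
    show "fps_nth (\<Phi> 0) (Suc k) = b 0 * fps_nth (\<Phi> 0) k + l 0 * fps_nth (\<Phi> 1) k" for k
      by (subst Phi_0) simp
    show "fps_nth (\<Phi> (Suc n)) (Suc k) = fps_nth (\<Phi> n) k + b (Suc n) * fps_nth (\<Phi> (Suc n)) k
        + l (Suc n) * fps_nth (\<Phi> (Suc (Suc n))) k" for k n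
      by (subst Phi_Suc) simp
  qed
  then show ?thesis by (simp add: f_eq)
qed

section \<open>Contiguous relations for Gauss hypergeometric series\<close>

text \<open>
  The series \<open>F(a, b; c; sX)\<close>. Where some \<open>pochhammer c k\<close> vanishes the coefficient is
  \<open>0\<close> by the convention for division, which is why the contiguous relations below assume that
  \<open>c\<close> is not a nonpositive integer.
\<close>
definition hyp :: "'a::field_char_0 \<Rightarrow> 'a \<Rightarrow> 'a \<Rightarrow> 'a \<Rightarrow> 'a fps" where
  "hyp s a b c = Abs_fps (\<lambda>k. pochhammer a k * pochhammer b k / (pochhammer c k * fact k) * s ^ k)"

lemma hyp_nth: "fps_nth (hyp s a b c) k =
    pochhammer a k * pochhammer b k / (pochhammer c k * fact k) * s ^ k"
  by (simp add: hyp_def)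

lemma hyp_nth_0 [simp]: "fps_nth (hyp s a b c) 0 = 1"
  by (simp add: hyp_nth)

lemma hyp_commute: "hyp s a b c = hyp s b a c"
  by (simp add: hyp_def mult.commute)

lemma hyp_gauss:
  fixes c :: "'a::field_char_0"
  assumes c: "\<And>k. c + of_nat k \<noteq> 0"
  shows "hyp s a b c = hyp s a (b + 1) (c + 1)
    + fps_const (s * (a * (b - c) / (c * (c + 1)))) * fps_X * hyp s (a + 1) (b + 1) (c + 2)"
proof (rule fps_ext)
  fix k
  show "fps_nth (hyp s a b c) k = fps_nth (hyp s a (b + 1) (c + 1)
    + fps_const (s * (a * (b - c) / (c * (c + 1)))) * fps_X * hyp s (a + 1) (b + 1) (c + 2)) k"
  proof (cases k)
    case 0
    then show ?thesis by simp
  next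
    case (Suc m)
    define A where "A = pochhammer (a + 1) m"
    define B where "B = pochhammer (b + 1) m"
    define C where "C = pochhammer (c + 2) m"
    have nz: "c \<noteq> 0" "c + 1 \<noteq> 0" "c + of_nat m + 1 \<noteq> 0" "C \<noteq> 0"
      using c[of 0] c[of 1] c[of "Suc m"] c[of "k + 2" for k]
      by (auto simp: C_def pochhammer_eq_0_iff add_ac eq_neg_iff_add_eq_0)
    have C_Suc: "pochhammer (c + 1) (Suc m) = (c + 1) * C"
      by (simp add: pochhammer_rec C_def add_ac)
    then have C1: "pochhammer (c + 1) m * (c + of_nat m + 1) = (c + 1) * C"
      by (simp add: pochhammer_Suc add_ac mult_ac)
    then have C0: "pochhammer c (Suc m) = c * (c + 1) * C / (c + of_nat m + 1)"
      using nz by (simp add: pochhammer_rec field_simps)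
    have m: "(of_nat m + 1 :: 'a) \<noteq> 0"
      by (metis of_nat_Suc of_nat_neq_0 add.commute)
    have ab: "pochhammer a (Suc m) = a * A" "pochhammer b (Suc m) = b * B"
      "pochhammer (b + 1) (Suc m) = B * (b + of_nat m + 1)"
      and fact: "fact (Suc m) = (of_nat m + 1) * (fact m :: 'a)"
      by (simp_all add: A_def B_def pochhammer_rec[of a] pochhammer_rec[of b] pochhammer_Suc[of "1 + b"]
          algebra_simps)
    have e1: "fps_nth (hyp s a b c) (Suc m) =
        a * A * (b * B) / (c * (c + 1) * C / (c + of_nat m + 1) * ((of_nat m + 1) * fact m)) * (s * s ^ m)"
      by (simp only: hyp_nth ab fact C0 power_Suc)
    have e2: "fps_nth (hyp s a (b + 1) (c + 1)) (Suc m) =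
        a * A * (B * (b + of_nat m + 1)) / ((c + 1) * C * ((of_nat m + 1) * fact m)) * (s * s ^ m)"
      by (simp only: hyp_nth ab fact C_Suc power_Suc)
    have e3: "fps_nth (hyp s (a + 1) (b + 1) (c + 2)) m = A * B / (C * fact m) * s ^ m"
      by (simp add: hyp_nth A_def B_def C_def)
    have "fps_nth (hyp s a (b + 1) (c + 1) + fps_const (s * (a * (b - c) / (c * (c + 1)))) * fps_X
          * hyp s (a + 1) (b + 1) (c + 2)) (Suc m) =
        fps_nth (hyp s a (b + 1) (c + 1)) (Suc m) + s * (a * (b - c) / (c * (c + 1))) * fps_nth (hyp s (a + 1) (b + 1) (c + 2)) m"
      by (simp add: mult.assoc)
    also have "\<dots> = fps_nth (hyp s a b c) (Suc m)"
      unfolding e1 e2 e3 using nz m by (simp add: divide_simps) (simp add: algebra_simps)?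
    finally show ?thesis by (simp only: Suc)
  qed
qed

text \<open>
  Unlike the previous relation, this one raises only a numerator parameter. It is needed only for
  the first, exceptional, step of the continued fraction.
\<close>

lemma hyp_raise_numerator:
  fixes c :: "'a::field_char_0"
  assumes c: "\<And>k. c + of_nat k \<noteq> 0"
  shows "hyp s a b c = hyp s a (b + 1) c
    - fps_const (s * (a / c)) * fps_X * hyp s (a + 1) (b + 1) (c + 1)"
proof (rule fps_ext)
  fix k
  show "fps_nth (hyp s a b c) k = fps_nth (hyp s a (b + 1) c
    - fps_const (s * (a / c)) * fps_X * hyp s (a + 1) (b + 1) (c + 1)) k"
  proof (cases k)
    case 0
    then show ?thesis by simp
  next
    case (Suc m)
    define A where "A = pochhammer (a + 1) m"
    define B where "B = pochhammer (b + 1) m"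
    define C where "C = pochhammer (c + 1) m"
    have nz: "c \<noteq> 0" "C \<noteq> 0"
      using c[of 0] c[of "k + 1" for k]
      by (auto simp: C_def pochhammer_eq_0_iff add_ac eq_neg_iff_add_eq_0)
    have m: "(of_nat m + 1 :: 'a) \<noteq> 0"
      by (metis of_nat_Suc of_nat_neq_0 add.commute)
    have abc: "pochhammer a (Suc m) = a * A" "pochhammer b (Suc m) = b * B"
      "pochhammer (b + 1) (Suc m) = B * (b + of_nat m + 1)" "pochhammer c (Suc m) = c * C"
      and fact: "fact (Suc m) = (of_nat m + 1) * (fact m :: 'a)"
      by (simp_all add: A_def B_def C_def pochhammer_rec[of a] pochhammer_rec[of b] pochhammer_rec[of c]
          pochhammer_Suc[of "1 + b"] algebra_simps)
    have e1: "fps_nth (hyp s a b c) (Suc m) = a * A * (b * B) / (c * C * ((of_nat m + 1) * fact m)) * (s * s ^ m)"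
      by (simp only: hyp_nth abc fact power_Suc)
    have e2: "fps_nth (hyp s a (b + 1) c) (Suc m) =
        a * A * (B * (b + of_nat m + 1)) / (c * C * ((of_nat m + 1) * fact m)) * (s * s ^ m)"
      by (simp only: hyp_nth abc fact power_Suc)
    have e3: "fps_nth (hyp s (a + 1) (b + 1) (c + 1)) m = A * B / (C * fact m) * s ^ m"
      by (simp add: hyp_nth A_def B_def C_def)
    have "fps_nth (hyp s a (b + 1) c - fps_const (s * (a / c)) * fps_X
          * hyp s (a + 1) (b + 1) (c + 1)) (Suc m) =
        fps_nth (hyp s a (b + 1) c) (Suc m) - s * (a / c) * fps_nth (hyp s (a + 1) (b + 1) (c + 1)) m"
      by (simp add: mult.assoc)
    also have "\<dots> = fps_nth (hyp s a b c) (Suc m)"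
      unfolding e1 e2 e3 using nz m by (simp add: divide_simps) (simp add: algebra_simps)?
    finally show ?thesis by (simp only: Suc)
  qed
qed

text \<open>
  Two contiguous relations, raising \<open>b\<close> and \<open>a\<close> alternately, are contracted to one step of
  a Jacobi continued fraction.
\<close>

lemma hyp_three_term:
  fixes s a b c :: "'a::field_char_0"
  assumes c: "\<And>k. c + of_nat k \<noteq> 0"
  defines "\<kappa>1 \<equiv> s * (a * (b - c) / (c * (c + 1)))"
    and "\<kappa>2 \<equiv> s * ((b + 1) * (a - c - 1) / ((c + 1) * (c + 2)))"
    and "\<kappa>3 \<equiv> s * ((a + 1) * (b - c - 1) / ((c + 2) * (c + 3)))"
  shows "hyp s a b c = (1 - fps_const (- \<kappa>1 - \<kappa>2) * fps_X) * hyp s (a + 1) (b + 1) (c + 2)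
    - fps_const (\<kappa>2 * \<kappa>3) * fps_X ^ 2 * hyp s (a + 2) (b + 2) (c + 4)"
proof -
  have c1: "c + 1 + of_nat k \<noteq> 0" "c + 2 + of_nat k \<noteq> 0" for k
    using c[of "k + 1"] c[of "k + 2"] by (simp_all add: add_ac)
  have numerals: "x + 1 + 1 = x + 2" "x + 1 + 2 = x + 3" "x + 2 + 1 = x + 3" "x + 2 + 2 = x + 4" for x :: 'a
    by simp_all
  have diff: "a - c - 1 = a - (c + 1)" "b - c - 1 = b + 1 - (c + 2)"
    by simp_all
  have 1: "hyp s a b c = hyp s a (b + 1) (c + 1) + fps_const \<kappa>1 * fps_X * hyp s (a + 1) (b + 1) (c + 2)"
    unfolding \<kappa>1_def by (rule hyp_gauss[OF c])
  have 2: "hyp s a (b + 1) (c + 1) = hyp s (a + 1) (b + 1) (c + 2)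
      + fps_const \<kappa>2 * fps_X * hyp s (a + 1) (b + 2) (c + 3)"
    using hyp_gauss[OF c1(1), of s "b + 1" a] unfolding \<kappa>2_def
    by (simp only: hyp_commute[of s "b + 1"] hyp_commute[of s "b + 2"] numerals diff)
  have 3: "hyp s (a + 1) (b + 1) (c + 2) = hyp s (a + 1) (b + 2) (c + 3)
      + fps_const \<kappa>3 * fps_X * hyp s (a + 2) (b + 2) (c + 4)"
    using hyp_gauss[OF c1(2), of s "a + 1" "b + 1"] unfolding \<kappa>3_def
    by (simp only: numerals diff)
  from 3 have 4: "hyp s (a + 1) (b + 2) (c + 3) =
      hyp s (a + 1) (b + 1) (c + 2) - fps_const \<kappa>3 * fps_X * hyp s (a + 2) (b + 2) (c + 4)"
    by simp
  show ?thesis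
    unfolding 1 2 4
    by (simp add: algebra_simps power2_eq_square flip: fps_const_mult fps_const_add fps_const_neg fps_const_sub)
qed

lemma hyp_deriv:
  fixes c :: "'a::field_char_0"
  assumes "c \<noteq> 0"
  shows "fps_deriv (hyp s a b c) = fps_const (s * (a * b / c)) * hyp s (a + 1) (b + 1) (c + 1)"
proof (rule fps_ext)
  fix k
  have "(of_nat k + 1 :: 'a) \<noteq> 0"
    by (metis of_nat_Suc of_nat_neq_0 add.commute)
  then show "fps_nth (fps_deriv (hyp s a b c)) k =
      fps_nth (fps_const (s * (a * b / c)) * hyp s (a + 1) (b + 1) (c + 1)) k"
    using assms by (simp add: hyp_nth pochhammer_rec divide_simps add_ac)
qed

lemma binom_3k_as_hyp:
  "Abs_fps (\<lambda>k. of_nat ((3 * k) choose k)) = hyp (27 / 4 :: 'a::field_char_0) (1 / 3) (2 / 3) (1 / 2)"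
proof (rule fps_ext)
  fix k
  have "of_nat ((3 * k) choose k) = (fact (3 * k) / (fact k * fact (2 * k)) :: 'a)"
    by (subst binomial_fact) auto
  also have "\<dots> = pochhammer (1 / 3) k * pochhammer (2 / 3) k / (pochhammer (1 / 2) k * fact k) * (27 / 4) ^ k"
  proof (induction k)
    case 0
    then show ?case by simp
  next
    case (Suc k)
    have f3: "fact (3 * Suc k) = (of_nat (3 * k + 3) * of_nat (3 * k + 2) * of_nat (3 * k + 1) * fact (3 * k) :: 'a)"
      by (simp add: eval_nat_numeral algebra_simps)
    have f2: "fact (2 * Suc k) = (of_nat (2 * k + 2) * of_nat (2 * k + 1) * fact (2 * k) :: 'a)"
      by (simp add: eval_nat_numeral algebra_simps)
    have nz: "of_nat (2 * k + 2) \<noteq> (0::'a)" "of_nat (2 * k + 1) \<noteq> (0::'a)" "of_nat (k + 1) \<noteq> (0::'a)"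
      "of_nat (3 * k + 3) \<noteq> (0::'a)"
      by (simp_all only: of_nat_eq_0_iff)
    have half: "1 / 2 + of_nat k = (of_nat (2 * k + 1) / 2 :: 'a)"
      "1 / 3 + of_nat k = (of_nat (3 * k + 1) / 3 :: 'a)" "2 / 3 + of_nat k = (of_nat (3 * k + 2) / 3 :: 'a)"
      by (simp_all add: field_simps)
    have r: "of_nat (3 * k + 3) = (3 * of_nat (k + 1) :: 'a)" "of_nat (2 * k + 2) = (2 * of_nat (k + 1) :: 'a)"
      by (simp_all add: algebra_simps)
    have fs: "fact (Suc k) = (of_nat (k + 1) * fact k :: 'a)" by simp
    have "fact (3 * Suc k) / (fact (Suc k) * fact (2 * Suc k)) =
      (fact (3 * k) / (fact k * fact (2 * k)) :: 'a) *
        (of_nat (3 * k + 1) / 3 * (of_nat (3 * k + 2) / 3) / (of_nat (2 * k + 1) / 2 * of_nat (k + 1)) * (27 / 4))"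
      unfolding f3 f2 fs r using nz(2,3) by (simp del: of_nat_add of_nat_Suc of_nat_mult add: divide_simps)
    also note Suc.IH
    also have "pochhammer (1 / 3) k * pochhammer (2 / 3) k / (pochhammer (1 / 2) k * fact k) * (27 / 4) ^ k *
       (of_nat (3 * k + 1) / 3 * (of_nat (3 * k + 2) / 3) / (of_nat (2 * k + 1) / 2 * of_nat (k + 1)) * (27 / 4)) =
       pochhammer (1 / 3) (Suc k) * pochhammer (2 / 3) (Suc k) / (pochhammer (1 / 2) (Suc k) * fact (Suc k)) * (27 / 4 :: 'a) ^ Suc k"
      unfolding pochhammer_Suc half fs by (simp del: of_nat_add of_nat_Suc of_nat_mult add: field_simps)
    finally show ?case .
  qed
  finally show "fps_nth (Abs_fps (\<lambda>k. of_nat ((3 * k) choose k))) k =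
      fps_nth (hyp (27 / 4 :: 'a) (1 / 3) (2 / 3) (1 / 2)) k"
    by (simp add: hyp_nth)
qed

section \<open>The generating function and the cubic series\<close>

text \<open>
  The substitution \<open>X = u / (1 + u)\<^sup>3\<close> is inverted under composition; then \<open>t = 1 + u\<close>.
\<close>

lemma ternary_fps_exists: "\<exists>t :: 'a::field fps. t = 1 + fps_X * t ^ 3"
proof -
  define p :: "'a fps" where "p = fps_X * inverse ((1 + fps_X) ^ 3)"
  define u where "u = fps_inv p"
  have p: "fps_nth p 0 = 0" "fps_nth p 1 \<noteq> 0"
    by (simp_all add: p_def)
  have u0: "fps_nth u 0 = 0" by (simp add: u_def fps_inv_def)
  have q: "p * (1 + fps_X) ^ 3 = fps_X"
    by (simp add: p_def mult.assoc inverse_mult_eq_1)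
  have "p oo u = fps_X"
    unfolding u_def by (rule fps_inv_right) (use p in auto)
  moreover have "(p * (1 + fps_X) ^ 3) oo u = (p oo u) * (1 + u) ^ 3"
    using u0 by (simp add: fps_compose_mult_distrib fps_compose_add_distrib fps_compose_power[symmetric])
  ultimately have "u = fps_X * (1 + u) ^ 3"
    using q u0 by simp
  then show ?thesis by (intro exI[of _ "1 + u"]) simp
qed

text \<open>
  The recurrence determines the whole family from \<open>B 0\<close>, since the coefficient \<open>k + 1\<close> of
  \<open>B (r + 1) - B r\<close> is the coefficient \<open>k\<close> of \<open>B (r + 3)\<close>; and the powers of \<open>t\<close>
  satisfy the same recurrence.
\<close>

lemma ternary_family:
  fixes B :: "nat \<Rightarrow> 'a::comm_ring_1 fps"
  assumes t: "t = 1 + fps_X * t ^ 3"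
    and B: "\<And>r. B (Suc r) = B r + fps_X * B (r + 3)"
  shows "B r = t ^ r * B 0"
proof -
  define D where "D = (\<lambda>r. B r - t ^ r * B 0)"
  have tr: "t ^ Suc r = t ^ r + fps_X * t ^ (r + 3)" for r
    by (simp add: power_add, subst t) (simp add: algebra_simps)
  have D: "D (Suc r) = D r + fps_X * D (r + 3)" for r
    unfolding D_def B[of r] tr[of r] by (simp only: algebra_simps)
  have "fps_nth (D r) k = 0" for r k
  proof (induction k arbitrary: r)
    case 0
    show ?case
      by (induction r) (simp_all add: D, simp add: D_def)
  next
    case (Suc k)
    show ?case
      by (induction r) (simp_all add: D Suc, simp add: D_def)
  qed
  then have "D r = 0" by (intro fps_ext) simp
  then show ?thesis by (simp add: D_def)
qed

text \<open>
  The generating function of the polynomials \<open>\<Sum>\<^sub>m (3k+r-m choose k-m) x\<^sup>m\<close>. The case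
  \<open>r = 1\<close> is the sequence of the theorem; since \<open>0 ^ 0 = 1\<close>, the case \<open>x = 0\<close> has the
  coefficients \<open>3k+r choose k\<close>.
\<close>

definition a_fps :: "'a::comm_ring_1 \<Rightarrow> nat \<Rightarrow> 'a fps" where
  "a_fps x r = Abs_fps (\<lambda>k. \<Sum>m=0..k. of_nat ((3 * k + r - m) choose (k - m)) * x ^ m)"

lemma a_fps_rec: "a_fps x (Suc r) = a_fps x r + fps_X * a_fps x (r + 3)"
proof (rule fps_ext)
  fix k
  show "fps_nth (a_fps x (Suc r)) k = fps_nth (a_fps x r + fps_X * a_fps x (r + 3)) k"
  proof (cases k)
    case 0
    then show ?thesis by (simp add: a_fps_def)
  next
    case (Suc k')
    have pascal: "(3 * k + Suc r - m) choose (k - m) =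
        ((3 * k + r - m) choose (k - m)) + ((3 * k' + (r + 3) - m) choose (k' - m))" if "m \<le> k'" for m
    proof -
      have "3 * k + Suc r - m = Suc (3 * k + r - m)" "k - m = Suc (k' - m)"
        "3 * k' + (r + 3) - m = 3 * k + r - m"
        using that Suc by auto
      then show ?thesis by simp
    qed
    have "(\<Sum>m=0..k'. of_nat ((3 * k + Suc r - m) choose (k - m)) * x ^ m) =
      (\<Sum>m=0..k'. of_nat ((3 * k + r - m) choose (k - m)) * x ^ m) +
      (\<Sum>m=0..k'. of_nat ((3 * k' + (r + 3) - m) choose (k' - m)) * x ^ m)"
      unfolding sum.distrib[symmetric]
      by (intro sum.cong refl) (simp only: pascal of_nat_add distrib_right atLeastAtMost_iff)
    then show ?thesis
      unfolding a_fps_def by (simp add: Suc)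
  qed
qed

text \<open>Separates the summand \<open>m = 0\<close>.\<close>

lemma a_fps_split: "a_fps x 1 = a_fps 0 1 + fps_const x * fps_X * a_fps x 3"
proof (rule fps_ext)
  fix k
  show "fps_nth (a_fps x 1) k = fps_nth (a_fps 0 1 + fps_const x * fps_X * a_fps x 3) k"
  proof (cases k)
    case 0
    then show ?thesis by (simp add: a_fps_def)
  next
    case (Suc k')
    have "(\<Sum>m=0..k. of_nat ((3 * k + 1 - m) choose (k - m)) * x ^ m) =
      of_nat ((3 * k + 1) choose k) + x * (\<Sum>m=0..k'. of_nat ((3 * k' + 3 - m) choose (k' - m)) * x ^ m)"
      unfolding Suc sum.atLeast0_atMost_Suc_shift
      by (simp add: sum_distrib_left ac_simps)
    moreover have "(\<Sum>m=0..k. of_nat ((3 * k + 1 - m) choose (k - m)) * 0 ^ m) = (of_nat ((3 * k + 1) choose k) :: 'a)"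
      unfolding Suc sum.atLeast0_atMost_Suc_shift by simp
    ultimately show ?thesis
      by (simp add: a_fps_def Suc mult.assoc)
  qed
qed

text \<open>
  At \<open>x = 3\<close>, and only there, the factor \<open>1 - x X t\<^sup>2\<close> in \<open>a_fps x 1\<close> coincides with
  the reciprocal \<open>w\<close> of \<open>G\<close>; and \<open>w' = -3 t G\<close>.
\<close>

lemma a_fps_logarithmic_derivative:
  fixes G :: "'a::field_char_0 fps"
  defines "G \<equiv> Abs_fps (\<lambda>k. of_nat ((3 * k) choose k))"
  shows "fps_const 3 * (a_fps 3 1 * G) = fps_deriv G"
proof -
  obtain t :: "'a fps" where t: "t = 1 + fps_X * t ^ 3"
    using ternary_fps_exists by blast
  have G: "G = a_fps 0 0"
  proof (rule fps_ext)
    fix k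
    have "(\<Sum>m=0..k. of_nat ((3 * k - m) choose (k - m)) * 0 ^ m) = (of_nat ((3 * k) choose k) :: 'a)"
      by (cases k) (simp_all only: sum.atLeast0_atMost_Suc_shift, simp_all)
    then show "fps_nth G k = fps_nth (a_fps 0 0) k"
      by (simp add: G_def a_fps_def)
  qed
  have family: "a_fps x r = t ^ r * a_fps x 0" for x :: 'a and r
    by (rule ternary_family[OF t a_fps_rec])
  define w where "w = 1 - fps_const 3 * fps_X * t ^ 2"
  have Gw: "G * w = 1"
  proof -
    \<comment> \<open>This is \<open>(3k choose k) = 3 (3k-1 choose k-1)\<close> for \<open>k \<ge> 1\<close>.\<close>
    have "G = 1 + fps_const 3 * fps_X * a_fps 0 2"
    proof (rule fps_ext)
      fix k
      show "fps_nth G k = fps_nth (1 + fps_const 3 * fps_X * a_fps 0 2) k"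
      proof (cases k)
        case 0
        then show ?thesis by (simp add: G_def)
      next
        case (Suc k')
        have "Suc (3 * k' + 2) = 3 * Suc k'" by simp
        then have "((3 * Suc k') choose Suc k') * Suc k' = (3 * ((3 * k' + 2) choose k')) * Suc k'"
          using Suc_times_binomial_eq[of "3 * k' + 2" k'] by (simp only: mult_ac)
        then have "(3 * Suc k') choose Suc k' = 3 * ((3 * k' + 2) choose k')"
          by (simp only: mult_cancel2) simp
        moreover have "(\<Sum>m=0..k'. of_nat ((3 * k' + 2 - m) choose (k' - m)) * 0 ^ m)
            = (of_nat ((3 * k' + 2) choose k') :: 'a)"
          by (cases k') (simp_all only: sum.atLeast0_atMost_Suc_shift, simp_all)
        ultimately show ?thesis
          by (simp add: G_def a_fps_def Suc mult.assoc del: mult_Suc_right)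
      qed
    qed
    also have "a_fps 0 2 = t ^ 2 * G"
      unfolding G by (rule family)
    finally show ?thesis by (simp add: w_def algebra_simps)
  qed
  have aw: "a_fps 3 1 * w = t * G"
  proof -
    have "a_fps 3 3 = t ^ 2 * a_fps (3 :: 'a) 1"
      unfolding family[of 3 3] family[of 3 1] by (simp add: power3_eq_cube power2_eq_square mult_ac)
    moreover have "a_fps 0 1 = t * G"
      unfolding G family[of 0 1] by simp
    ultimately have "a_fps 3 1 = t * G + fps_const 3 * fps_X * (t ^ 2 * a_fps 3 1)"
      using a_fps_split[of "3 :: 'a"] by simp
    then show ?thesis by (simp add: w_def algebra_simps)
  qed
  have a: "a_fps 3 1 = t * G ^ 2"
  proof -
    have "a_fps 3 1 = a_fps 3 1 * (G * w)" by (simp add: Gw)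
    also have "\<dots> = (a_fps 3 1 * w) * G" by (simp only: mult_ac)
    also have "\<dots> = t * G ^ 2" unfolding aw by (simp add: power2_eq_square mult_ac)
    finally show ?thesis .
  qed
  have dt: "fps_deriv t = t ^ 3 * G"
  proof -
    have "fps_deriv t = fps_deriv (1 + fps_X * t ^ 3)"
      using t by simp
    also have "\<dots> = t ^ 3 + fps_const 3 * fps_X * t ^ 2 * fps_deriv t"
      by (simp add: fps_deriv_power' fps_numeral_fps_const algebra_simps)
    finally have "fps_deriv t * w = t ^ 3"
      by (simp add: w_def algebra_simps)
    then have "t ^ 3 * G = fps_deriv t * (G * w)"
      by (simp add: mult_ac)
    then show ?thesis by (simp add: Gw)
  qed
  have dw: "fps_deriv w = - (fps_const 3 * t * G)"
  proof -
    have "t \<noteq> 0"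
      using t by (metis mult_zero_right one_neq_zero power_0_left add_0_right zero_neq_numeral)
    have Xt: "fps_X * t ^ 3 = t - 1"
      using t by (metis add_diff_cancel_left')
    have "t * w = t - 3 * (fps_X * t ^ 3)"
      by (simp add: w_def algebra_simps power3_eq_cube power2_eq_square flip: fps_numeral_fps_const)
    then have tw: "t * w = 3 - 2 * t"
      unfolding Xt by (simp add: algebra_simps)
    have "fps_deriv (t * w) = fps_deriv (3 - 2 * t)" by (simp only: tw)
    then have "t * fps_deriv w + w * fps_deriv t = - (2 * fps_deriv t)"
      by (simp add: algebra_simps)
    then have "t * fps_deriv w = - (2 * fps_deriv t) - w * fps_deriv t"
      by (metis add_diff_cancel_right')
    then have "t * (t * fps_deriv w) = t * (- (2 * fps_deriv t) - w * fps_deriv t)"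
      by (simp only:)
    also have "\<dots> = - (2 * t + t * w) * fps_deriv t"
      by (simp add: algebra_simps)
    also have "\<dots> = t * (t * (- (fps_const 3 * t * G)))"
      unfolding tw dt by (simp add: algebra_simps power3_eq_cube flip: fps_numeral_fps_const)
    finally show ?thesis
      using \<open>t \<noteq> 0\<close> by (metis mult_left_cancel)
  qed
  have "fps_deriv G * w + G * fps_deriv w = 0"
    using arg_cong[OF Gw, of fps_deriv] by (simp add: algebra_simps)
  then have dG: "fps_deriv G * w = fps_const 3 * t * G ^ 2"
    unfolding dw by (simp add: algebra_simps power2_eq_square)
  have "fps_deriv G = fps_deriv G * w * G"
    by (simp add: mult.assoc mult.commute[of w] Gw)
  also have "\<dots> = fps_const 3 * (a_fps 3 1 * G)"
    unfolding dG a by (simp add: power2_eq_square mult_ac)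
  finally show ?thesis by simp
qed

section \<open>The continued fraction and its coefficients\<close>

text \<open>The normalised remainders of the continued fraction of \<open>G' / (3 G)\<close>.\<close>

definition psi :: "nat \<Rightarrow> rat fps" where
  "psi n = hyp (27 / 4) (of_nat n + 4 / 3) (of_nat n + 5 / 3) (2 * of_nat n + 3 / 2)"

text \<open>
  The coefficients of \<open>X\<^sup>2\<close> in that continued fraction, indexed from \<open>0\<close>. The only negative
  one is \<open>lam 0 = -1\<close>, from the factor \<open>6 n - 1\<close>; it causes the sign in the theorem.
\<close>

definition lam :: "nat \<Rightarrow> rat" where
  "lam n = 9 * (6 * of_nat n + 1) * (6 * of_nat n - 1) * (3 * of_nat n + 4) * (3 * of_nat n + 5)
    / (4 * (4 * of_nat n + 1) * (4 * of_nat n + 3) ^ 2 * (4 * of_nat n + 5))"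

lemma half_odd_nonzero: "2 * of_nat n + 3 / 2 + of_nat k \<noteq> (0 :: rat)"
proof -
  have "0 < 2 * of_nat n + 3 / 2 + (of_nat k :: rat)"
    by (intro add_nonneg_pos add_pos_nonneg) auto
  then show ?thesis by simp
qed

text \<open>
  The coefficient \<open>\<beta>\<close> does not enter the determinant, so its value is left unspecified.
\<close>

lemma psi_step:
  "\<exists>\<beta>. psi n = (1 - fps_const \<beta> * fps_X) * psi (Suc n)
     - fps_const (lam (Suc n)) * fps_X ^ 2 * psi (Suc (Suc n))"
proof -
  define N :: rat where "N = of_nat n"
  have N: "N \<ge> 0" by (simp add: N_def)
  have lam: "27 / 4 * ((N + 5 / 3 + 1) * (N + 4 / 3 - (2 * N + 3 / 2) - 1)
          / ((2 * N + 3 / 2 + 1) * (2 * N + 3 / 2 + 2)))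
      * (27 / 4 * ((N + 4 / 3 + 1) * (N + 5 / 3 - (2 * N + 3 / 2) - 1)
          / ((2 * N + 3 / 2 + 2) * (2 * N + 3 / 2 + 3)))) = lam (Suc n)"
  proof -
    have 1: "(N + 5 / 3 + 1) = (3 * N + 8) / 3" "(N + 4 / 3 - (2 * N + 3 / 2) - 1) = - (6 * N + 7) / 6"
      "2 * N + 3 / 2 + 1 = (4 * N + 5) / 2" "2 * N + 3 / 2 + 2 = (4 * N + 7) / 2"
      "2 * N + 3 / 2 + 3 = (4 * N + 9) / 2"
      "N + 4 / 3 + 1 = (3 * N + 7) / 3" "(N + 5 / 3 - (2 * N + 3 / 2) - 1) = - (6 * N + 5) / 6"
      by (simp_all add: field_simps)
    have 2: "6 * of_nat (Suc n) + 1 = 6 * N + 7" "6 * of_nat (Suc n) - 1 = 6 * N + 5"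
      "3 * of_nat (Suc n) + 4 = 3 * N + 7" "3 * of_nat (Suc n) + 5 = 3 * N + 8"
      "4 * of_nat (Suc n) + 1 = 4 * N + 5" "4 * of_nat (Suc n) + 3 = 4 * N + 7"
      "4 * of_nat (Suc n) + 5 = 4 * N + 9"
      by (simp_all add: N_def)
    show ?thesis
      unfolding lam_def 1 2 using N by (simp add: divide_simps power2_eq_square) (simp add: algebra_simps)
  qed
  have p: "psi n = hyp (27 / 4) (N + 4 / 3) (N + 5 / 3) (2 * N + 3 / 2)"
    "psi (Suc n) = hyp (27 / 4) (N + 4 / 3 + 1) (N + 5 / 3 + 1) (2 * N + 3 / 2 + 2)"
    "psi (Suc (Suc n)) = hyp (27 / 4) (N + 4 / 3 + 2) (N + 5 / 3 + 2) (2 * N + 3 / 2 + 4)"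
    by (simp_all add: psi_def N_def algebra_simps)
  show ?thesis
    unfolding p lam[symmetric]
    by (rule exI, rule hyp_three_term) (simp add: N_def half_odd_nonzero)
qed

text \<open>
  The left-hand side is \<open>G\<close>. It does not continue the family \<open>psi\<close> downwards, which would
  give \<open>F(1/3, 2/3; -1/2; 27X/4)\<close>; this affects only the coefficient of \<open>X\<close>.
\<close>

lemma psi_start:
  "hyp (27 / 4) (1 / 3) (2 / 3) (1 / 2) =
     (1 - fps_const 7 * fps_X) * psi 0 - fps_const (lam 0) * fps_X ^ 2 * psi 1"
proof -
  let ?F = "hyp (27 / 4 :: rat)"
  have half: "1 / 2 + of_nat k \<noteq> (0 :: rat)" for k
    using add_pos_nonneg[of "1 / 2 :: rat" "of_nat k"] by simp
  have 1: "?F (1/3) (2/3) (1/2) = ?F (1/3) (5/3) (1/2) + fps_const (- 9/2) * fps_X * ?F (4/3) (5/3) (3/2)"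
    using hyp_raise_numerator[OF half, of "27/4" "1/3" "2/3"] by (simp flip: fps_const_neg)
  have 2: "?F (1/3) (5/3) (1/2) = ?F (4/3) (5/3) (3/2) + fps_const (- 5/2) * fps_X * ?F (4/3) (8/3) (5/2)"
    using hyp_gauss[OF half, of "27/4" "5/3" "1/3"]
    by (simp add: hyp_commute[of _ "5/3"] hyp_commute[of _ "8/3"])
  have 3: "?F (4/3) (5/3) (3/2) = ?F (4/3) (8/3) (5/2) + fps_const (2/5) * fps_X * ?F (7/3) (8/3) (7/2)"
    using hyp_gauss[OF half_odd_nonzero[of 0, simplified], of "27/4" "4/3" "5/3"] by simp
  then have 4: "?F (4/3) (8/3) (5/2) = ?F (4/3) (5/3) (3/2) - fps_const (2/5) * fps_X * ?F (7/3) (8/3) (7/2)"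
    by simp
  have 5: "fps_const (7 :: rat) = - fps_const (- 9/2) - fps_const (- 5/2)"
    by simp
  have 6: "fps_const (lam 0) = fps_const (- 5/2) * fps_const (2/5)"
    by (simp add: lam_def)
  show ?thesis
    unfolding 1 2 4 5 6 psi_def
    by (simp add: algebra_simps power2_eq_square
        del: fps_const_neg fps_const_sub fps_const_add fps_const_mult)
qed

text \<open>
  At \<open>i = 0\<close> the formula fails, since the empty product is \<open>1\<close> and the subtractions
  truncate.
\<close>

lemma prod_lam:
  assumes "i \<ge> 1"
  shows "(\<Prod>j<i. lam j) = - ((fact (6 * i - 3) * fact (3 * i + 2) * fact (2 * i - 1)) /
      (fact (4 * i - 1) * fact (4 * i + 1) * fact (3 * i - 2)))"
  using assms
proof (induction i rule: dec_induct)
  case base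
  show ?case by (simp add: lam_def eval_nat_numeral)
next
  case (step i)
  then obtain m where i: "i = Suc m" by (cases i) auto
  define M :: rat where "M = of_nat m"
  have M: "M \<ge> 0" by (simp add: M_def)
  have e: "6 * Suc i - 3 = 6 * m + 9" "3 * Suc i + 2 = 3 * m + 8" "2 * Suc i - 1 = 2 * m + 3"
    "4 * Suc i - 1 = 4 * m + 7" "4 * Suc i + 1 = 4 * m + 9" "3 * Suc i - 2 = 3 * m + 4"
    "6 * i - 3 = 6 * m + 3" "3 * i + 2 = 3 * m + 5" "2 * i - 1 = 2 * m + 1"
    "4 * i - 1 = 4 * m + 3" "4 * i + 1 = 4 * m + 5" "3 * i - 2 = 3 * m + 1"
    by (simp_all add: i)
  have f: "fact (6 * m + 9) = (6*M+9)*(6*M+8)*(6*M+7)*(6*M+6)*(6*M+5)*(6*M+4) * fact (6 * m + 3)"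
    "fact (3 * m + 8) = (3*M+8)*(3*M+7)*(3*M+6) * fact (3 * m + 5)"
    "fact (2 * m + 3) = (2*M+3)*(2*M+2) * fact (2 * m + 1)"
    "fact (4 * m + 7) = (4*M+7)*(4*M+6)*(4*M+5)*(4*M+4) * fact (4 * m + 3)"
    "fact (4 * m + 9) = (4*M+9)*(4*M+8)*(4*M+7)*(4*M+6) * fact (4 * m + 5)"
    "fact (3 * m + 4) = (3*M+4)*(3*M+3)*(3*M+2) * fact (3 * m + 1)"
    by (simp_all add: M_def eval_nat_numeral algebra_simps)
  have l: "lam i = 9 * (6*M+7)*(6*M+5)*(3*M+7)*(3*M+8) / (4*(4*M+5)*(4*M+7)^2*(4*M+9))"
    by (simp add: lam_def i M_def algebra_simps)
  \<comment> \<open>After these factorizations the quotient of consecutive values reduces by cancelling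
    linear factors, without expanding polynomials in \<open>M\<close>.\<close>
  have fac: "6*M+9 = 3*(2*M+3)" "6*M+8 = 2*(3*M+4)" "6*M+6 = 6*(M+1)" "6*M+4 = 2*(3*M+2)"
    "3*M+6 = 3*(M+2)" "2*M+2 = 2*(M+1)" "4*M+6 = 2*(2*M+3)" "4*M+4 = 4*(M+1)" "4*M+8 = 4*(M+2)"
    "3*M+3 = 3*(M+1)"
    by simp_all
  have nz: "2*M+3 \<noteq> 0" "3*M+4 \<noteq> 0" "M+1 \<noteq> 0" "3*M+2 \<noteq> 0" "M+2 \<noteq> 0" "4*M+7 \<noteq> 0" "4*M+5 \<noteq> 0"
    "4*M+9 \<noteq> 0"
    using M by auto
  have cancel: "- (F1 * F2 * F3 / (F4 * F5 * F6)) * (9 * d1 * d2 * d3 * d4 / (4 * x * w ^ 2 * y)) =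
      - ((3 * p * (2 * q) * d1 * (6 * r) * d2 * (2 * u) * F1) * (d4 * d3 * (3 * v) * F2) * (p * (2 * r) * F3) /
        ((w * (2 * p) * x * (4 * r) * F4) * (y * (4 * v) * w * (2 * p) * F5) * (q * (3 * r) * u * F6)))"
    if "p \<noteq> 0" "q \<noteq> 0" "r \<noteq> 0" "u \<noteq> 0" "v \<noteq> 0"
    for p q r u v w x y d1 d2 d3 d4 F1 F2 F3 F4 F5 F6 :: rat
    using that by (simp add: divide_simps power2_eq_square)
  show ?case
    unfolding prod.lessThan_Suc step.IH e f l fac
    by (rule cancel) (use nz in auto)
qed

theorem corollary1:
  fixes n :: nat
  shows "hankel_H n (3::rat) = (-1) ^ n *
    (\<Prod>i=1..n. (fact (6 * i - 3) * fact (3 * i + 2) * fact (2 * i - 1)) /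
      (fact (4 * i - 1) * fact (4 * i + 1) * fact (3 * i - 2)))"
proof -
  define G :: "rat fps" where "G = Abs_fps (\<lambda>k. of_nat ((3 * k) choose k))"
  have G: "G = hyp (27 / 4) (1 / 3) (2 / 3) (1 / 2)"
    unfolding G_def by (rule binom_3k_as_hyp)
  have a: "a_seq k 3 = fps_nth (a_fps (3 :: rat) 1) k" for k
    by (simp add: a_seq_def a_fps_def)
  have "fps_const 3 * (a_fps 3 1 * G) = fps_const 3 * psi 0"
    using a_fps_logarithmic_derivative[where ?'a = rat] hyp_deriv[of "1/2" "27/4" "1/3" "2/3 :: rat"]
    by (simp add: G psi_def flip: G_def)
  then have aG: "a_fps 3 1 * G = psi 0" by simp
  obtain \<beta> where \<beta>: "\<And>n. psi n = (1 - fps_const (\<beta> n) * fps_X) * psi (Suc n)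
     - fps_const (lam (Suc n)) * fps_X ^ 2 * psi (Suc (Suc n))"
    using psi_step by metis
  have "hankel_H n (3 :: rat) = (\<Prod>i\<le>n. \<Prod>j<i. lam j)"
    unfolding hankel_H_def a
  proof (rule hankel_det_three_term[where \<psi> = psi and G = G and b = "case_nat 7 \<beta>"])
    show "fps_nth G 0 = 1" by (simp add: G)
    show "fps_nth (psi n) 0 = 1" for n by (simp add: psi_def)
    show "G = (1 - fps_const (case_nat 7 \<beta> 0) * fps_X) * psi 0 - fps_const (lam 0) * fps_X ^ 2 * psi 1"
      unfolding G by (simp only: psi_start nat.case)
    show "psi n = (1 - fps_const (case_nat 7 \<beta> (Suc n)) * fps_X) * psi (Suc n)
       - fps_const (lam (Suc n)) * fps_X ^ 2 * psi (Suc (Suc n))" for n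
      by (simp only: nat.case) (rule \<beta>)
    show "a_fps 3 1 * G = psi 0" by (rule aG)
  qed
  \<comment> \<open>The factor \<open>i = 0\<close> is an empty product.\<close>
  also have "\<dots> = (\<Prod>i=1..n. \<Prod>j<i. lam j)"
    by (simp add: atMost_atLeast0 prod.atLeast_Suc_atMost)
  also have "\<dots> = (\<Prod>i=1..n. (-1) * ((fact (6 * i - 3) * fact (3 * i + 2) * fact (2 * i - 1)) /
      (fact (4 * i - 1) * fact (4 * i + 1) * fact (3 * i - 2))))"
    by (intro prod.cong refl) (simp add: prod_lam)
  finally show ?thesis
    by (simp only: prod.distrib prod_constant) simp
qed

end
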